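(* For every integer $N\ge4$, $$\varpi_N<\varpi_{N+2},$$ where $\varpi_N=\lambda_{1,N}\,\lambda_{\lfloor N/2\rfloor,N}$ is the product of the smallest and the largest positive zeros of the physicists' Hermite polynomial $H_N$.
   Context: $H_N$ denotes the physicists' Hermite polynomial of degree $N$, $H_N(x)=(-1)^N e^{x^2}\frac{d^N}{dx^N}e^{-x^2}$. All its zeros are real and simple, and exactly $\lfloor N/2\rfloor$ of them are positive; the positive zeros are written in increasing order as $0<\lambda_{1,N}<\cdots<\lambda_{\lfloor N/2\rfloor,N}$. *)

theory Defs
  imports "HOL-Analysis.Analysis"
begin

definition hermite :: "nat \<Rightarrow> real \<Rightarrow> real" where
  "hermite N x = (-1) ^ N * exp (x\<^sup>2) * (deriv ^^ N) (\<lambda>t. exp (- (t\<^sup>2))) x"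

definition hermite_pos_zeros :: "nat \<Rightarrow> real set" where
  "hermite_pos_zeros N = {x. 0 < x \<and> hermite N x = 0}"

(* The k-th positive zero in increasing order, counted from 1; meaningful only
   for 1 \<le> k \<le> N div 2, the number of positive zeros. *)
definition hermite_zero :: "nat \<Rightarrow> nat \<Rightarrow> real" where
  "hermite_zero k N = sorted_list_of_set (hermite_pos_zeros N) ! (k - 1)"

definition varpi :: "nat \<Rightarrow> real" where
  "varpi N = hermite_zero 1 N * hermite_zero (N div 2) N"

end

theory Submission
  imports Defs "HOL-Computational_Algebra.Polynomial"
begin

text \<open>
  Substituting \<open>X = x\<^sup>2\<close> turns Hermite polynomials into Laguerre polynomials: up to a constant factor,
  \<open>H\<^sub>2\<^sub>n\<^sub>+\<^sub>e(x)\<close> is \<open>x\<^sup>e Y\<^sub>n(x\<^sup>2)\<close>, where \<open>Y\<^sub>n\<close> is the monic Laguerre polynomial with parameter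
  \<open>\<alpha> = c - 1\<close> and \<open>c = e + 1/2\<close>. Passing from \<open>N\<close> to \<open>N + 2\<close> is passing from \<open>n\<close> to \<open>n + 1\<close> with \<open>c\<close>
  fixed, so the claim is that the product of the extreme zeros of \<open>Y\<^sub>n\<close> increases with \<open>n\<close>. This is
  proved for \<open>0 < c \<le> 3/2\<close> and \<open>n \<ge> 2\<close> (\<open>laguerre_min_times_max_mono\<close>).

  The recurrence \<open>Y\<^sub>n\<^sub>+\<^sub>1 = (X - n - c) Y\<^sub>n - X Y\<^sub>n'\<close> reads \<open>Y\<^sub>n\<^sub>+\<^sub>1 = - \<Phi> Y\<^sub>n\<close> with
  \<open>\<Phi>(X) = \<Sum> X / (X - z) - X + n + c\<close>, the sum being over the zeros \<open>z\<close> of \<open>Y\<^sub>n\<close>. Let \<open>a\<close> and \<open>b\<close> be the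
  smallest and the largest zero of \<open>Y\<^sub>n\<close>. Suppose that \<open>\<Phi> > 0\<close> on \<open>(0, a/A]\<close> and at \<open>A b\<close>,
  with the same factor \<open>A = 1 + 1/s > 1\<close>. Then no zero of \<open>Y\<^sub>n\<^sub>+\<^sub>1\<close> is at most \<open>a/A\<close>, and one exceeds
  \<open>A b\<close>; multiplying the two bounds, the factor \<open>A\<close> cancels and the product exceeds \<open>a b\<close>.

  At both points the term of \<open>\<Phi>\<close> belonging to the nearby extreme zero is explicit (\<open>-s\<close> and \<open>s + 1\<close>),
  and the remaining terms are compared with their values at \<open>a\<close> and \<open>b\<close>: by monotonicity near
  \<open>a\<close>, and by the tangent line of a convex function near \<open>b\<close>. Those values and slopes are
  the Stieltjes sums \<open>\<Sum> 1/(a - z)\<close> and \<open>\<Sum> 1/(b - z)\<close>, \<open>\<Sum> 1/(b - z)\<^sup>2\<close>, which the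
  differential equation evaluates in closed form (\<open>laguerre_stieltjes\<close>).

  Positivity near \<open>a\<close> forces \<open>s\<close> to be slightly below \<open>n + c/2\<close>; by how much is controlled by
  \<open>a \<le> c (c + 1) / (n + c)\<close>, which comes from the sums of \<open>1/z\<close> and \<open>1/z\<^sup>2\<close>, and
  \<open>s = n + c/2 - c\<^sup>2/(2 n)\<close> suffices. Positivity near \<open>b\<close> then needs \<open>b\<close> to stay about \<open>6\<close>
  below \<open>4 n + 2 c\<close>, and this is what nonnegativity of \<open>\<Sum> z/(b - z)\<^sup>2\<close> says.
\<close>

section \<open>Monic Laguerre polynomials\<close>

text \<open>Up to the factor \<open>(-1)\<^sup>n n!\<close> this is the Laguerre polynomial \<open>L\<^sub>n\<close> with parameter
  \<open>\<alpha> = c - 1\<close>. The first-order recurrence in \<open>n\<close> is taken as the definition because it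
  relates the zeros of consecutive polynomials directly.\<close>

fun monic_laguerre :: "real \<Rightarrow> nat \<Rightarrow> real poly" where
  "monic_laguerre c 0 = 1"
| "monic_laguerre c (Suc n) =
     [:- (real n + c), 1:] * monic_laguerre c n - [:0, 1:] * pderiv (monic_laguerre c n)"

lemma poly_monic_laguerre_Suc:
  "poly (monic_laguerre c (Suc n)) x =
     (x - real n - c) * poly (monic_laguerre c n) x - x * poly (pderiv (monic_laguerre c n)) x"
  by (simp add: algebra_simps)

declare monic_laguerre.simps(2)[simp del]

text \<open>The differential equation for \<open>n\<close> yields this formula for the derivative at \<open>n + 1\<close>, and the
  formula yields the equation for \<open>n + 1\<close>; so the equation is proved by induction.\<close>

lemma pderiv_Suc_of_ode:
  assumes "\<And>x. x * poly (pderiv (pderiv (monic_laguerre c n))) x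
    + (c - x) * poly (pderiv (monic_laguerre c n)) x + n * poly (monic_laguerre c n) x = 0"
  shows "pderiv (monic_laguerre c (Suc n)) =
    smult (real (Suc n)) (monic_laguerre c n - pderiv (monic_laguerre c n))"
proof -
  have "poly (pderiv (monic_laguerre c (Suc n))) x =
    poly (smult (real (Suc n)) (monic_laguerre c n - pderiv (monic_laguerre c n))) x" for x
    using assms[of x]
    unfolding monic_laguerre.simps pderiv_mult pderiv_diff
    by (simp add: pderiv_pCons algebra_simps)
  then show ?thesis
    by (simp add: poly_eq_poly_eq_iff[symmetric] fun_eq_iff)
qed

lemma monic_laguerre_ode:
  "x * poly (pderiv (pderiv (monic_laguerre c n))) x
    + (c - x) * poly (pderiv (monic_laguerre c n)) x + n * poly (monic_laguerre c n) x = 0"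
proof (induction n arbitrary: x)
  case 0
  then show ?case by (simp add: pderiv_1)
next
  case (Suc n)
  define Y where "Y = monic_laguerre c n"
  note IH = Suc[folded Y_def]
  have d: "pderiv (monic_laguerre c (Suc n)) = smult (real (Suc n)) (Y - pderiv Y)"
    using pderiv_Suc_of_ode[OF Suc] by (simp add: Y_def)
  have "x * poly (pderiv (pderiv (monic_laguerre c (Suc n)))) x
     + (c - x) * poly (pderiv (monic_laguerre c (Suc n))) x
     + real (Suc n) * poly (monic_laguerre c (Suc n)) x
    = - real (Suc n) * (x * poly (pderiv (pderiv Y)) x + (c - x) * poly (pderiv Y) x + n * poly Y x)"
    unfolding d poly_monic_laguerre_Suc Y_def[symmetric]
    by (simp add: pderiv_smult pderiv_diff algebra_simps)
  then show ?case using IH[of x] by simp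
qed


lemma pderiv_linear_mult:
  fixes q :: "real poly"
  shows "pderiv ([:a, b:] * q) = smult b q + [:a, b:] * pderiv q"
  unfolding pderiv_mult by (simp add: pderiv_pCons algebra_simps)

lemma monic_laguerre_ode_pderiv:
  "x * poly (pderiv (pderiv (pderiv (monic_laguerre c n)))) x
    + (c + 1 - x) * poly (pderiv (pderiv (monic_laguerre c n))) x
    + (real n - 1) * poly (pderiv (monic_laguerre c n)) x = 0"
proof -
  define Y where "Y = monic_laguerre c n"
  have "[:0, 1:] * pderiv (pderiv Y) + [:c, -1:] * pderiv Y + smult (real n) Y = 0"
    using monic_laguerre_ode[of _ c n]
    by (simp add: poly_eq_poly_eq_iff[symmetric] fun_eq_iff Y_def algebra_simps)
  then have "poly (pderiv ([:0, 1:] * pderiv (pderiv Y) + [:c, -1:] * pderiv Y + smult (real n) Y)) x = 0"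
    by simp
  then show ?thesis
    unfolding Y_def[symmetric] pderiv_add pderiv_linear_mult pderiv_smult
    by (simp add: algebra_simps)
qed

lemma monic_laguerre_monic:
  "degree (monic_laguerre c n) = n \<and> lead_coeff (monic_laguerre c n) = 1"
proof (induction n)
  case 0
  then show ?case by simp
next
  case (Suc n)
  define Y where "Y = monic_laguerre c n"
  have Y: "degree Y = n" "lead_coeff Y = 1" using Suc by (auto simp: Y_def)
  then have "Y \<noteq> 0" by auto
  have d1: "degree ([:- (real n + c), 1:] * Y) = Suc n"
    using \<open>Y \<noteq> 0\<close> Y by (subst degree_mult_eq) auto
  have l1: "lead_coeff ([:- (real n + c), 1:] * Y) = 1"
    using Y by (simp only: lead_coeff_mult) simp
  have d2: "degree ([:0, 1:] * pderiv Y) \<le> n"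
  proof (cases "n = 0")
    case True
    then have "pderiv Y = 0" using Y by (simp add: pderiv_eq_0_iff)
    then show ?thesis by simp
  next
    case False
    then show ?thesis using Y degree_mult_le[of "[:0, 1:]" "pderiv Y"] by (auto simp: degree_pderiv)
  qed
  have e: "monic_laguerre c (Suc n) = [:- (real n + c), 1:] * Y + - ([:0, 1:] * pderiv Y)"
    unfolding Y_def monic_laguerre.simps by (rule diff_conv_add_uminus)
  have "degree (monic_laguerre c (Suc n)) = Suc n"
    unfolding e using d1 d2 by (subst degree_add_eq_left) (simp_all only: degree_minus)
  moreover have "coeff ([:0, 1:] * pderiv Y) (Suc n) = 0"
    using d2 by (intro coeff_eq_0) simp
  ultimately show ?case
    using l1 d1 unfolding e by (simp only: coeff_add coeff_minus minus_zero add_0_right simp_thms)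
qed

section \<open>Simplicity and positivity of the zeros\<close>

definition laguerre_zeros :: "real \<Rightarrow> nat \<Rightarrow> real set" where
  "laguerre_zeros c n = {x. poly (monic_laguerre c n) x = 0}"

lemma monic_laguerre_neq_0: "monic_laguerre c n \<noteq> 0"
  using monic_laguerre_monic[of c n] by auto

lemma finite_laguerre_zeros: "finite (laguerre_zeros c n)"
  unfolding laguerre_zeros_def by (rule poly_roots_finite[OF monic_laguerre_neq_0])

lemma card_laguerre_zeros_le: "card (laguerre_zeros c n) \<le> n"
  using card_poly_roots_bound[OF monic_laguerre_neq_0, of c n] monic_laguerre_monic[of c n]
  by (simp add: laguerre_zeros_def)

lemma monic_linear_factors:
  fixes Z :: "real set"
  shows "degree (\<Prod>z\<in>Z. [:- z, 1:]) = card Z \<and> lead_coeff (\<Prod>z\<in>Z. [:- z, 1:]) = 1"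
proof -
  have "degree (\<Prod>z\<in>Z. [:- z, 1:]) = card Z" by (simp add: degree_prod_sum_eq)
  moreover have "lead_coeff (\<Prod>z\<in>Z. [:- z, 1:]) = 1" unfolding lead_coeff_prod by simp
  ultimately show ?thesis by blast
qed

lemma monic_laguerre_factorization:
  assumes "card (laguerre_zeros c n) = n"
  shows "monic_laguerre c n = (\<Prod>z\<in>laguerre_zeros c n. [:- z, 1:])"
proof (rule poly_eqI_degree_lead_coeff[where A = "laguerre_zeros c n" and n = n])
  fix x assume "x \<in> laguerre_zeros c n"
  then show "poly (monic_laguerre c n) x = poly (\<Prod>z\<in>laguerre_zeros c n. [:- z, 1:]) x"
    using finite_laguerre_zeros by (auto simp: laguerre_zeros_def poly_prod)
qed (use assms monic_laguerre_monic[of c n] monic_linear_factors[of "laguerre_zeros c n"] in auto)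

lemma sign_linear_factors:
  fixes Z :: "real set"
  assumes "finite Z" "x \<notin> Z"
  shows "(-1) ^ card {z \<in> Z. x < z} * (\<Prod>z\<in>Z. x - z) > 0"
  using assms
proof (induction Z rule: finite_induct)
  case empty
  then show ?case by simp
next
  case (insert a Z)
  show ?case
  proof (cases "x < a")
    case True
    then have "{z \<in> insert a Z. x < z} = insert a {z \<in> Z. x < z}" by auto
    then have c: "card {z \<in> insert a Z. x < z} = Suc (card {z \<in> Z. x < z})"
      using insert by simp
    have "(a - x) * ((-1) ^ card {z \<in> Z. x < z} * (\<Prod>z\<in>Z. x - z)) > 0"
      using True insert.IH insert.prems by (intro mult_pos_pos[of "a - x"]) simp_all
    then show ?thesis unfolding c using insert.hyps by (simp add: algebra_simps)
  next
    case False
    then have c: "{z \<in> insert a Z. x < z} = {z \<in> Z. x < z}" by auto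
    have "(x - a) * ((-1) ^ card {z \<in> Z. x < z} * (\<Prod>z\<in>Z. x - z)) > 0"
      using False insert.IH insert.prems by (intro mult_pos_pos[of "x - a"]) simp_all
    then show ?thesis unfolding c using insert.hyps by (simp add: algebra_simps)
  qed
qed

lemma poly_pderiv_linear_factors_at_root:
  fixes Z :: "real set"
  assumes "finite Z" "a \<in> Z"
  shows "poly (pderiv (\<Prod>z\<in>Z. [:- z, 1:])) a = (\<Prod>z\<in>Z - {a}. a - z)"
proof -
  have "(\<Prod>z\<in>Z. [:- z, 1:]) = [:- a, 1:] * (\<Prod>z\<in>Z - {a}. [:- z, 1:])"
    using assms by (rule prod.remove)
  then show ?thesis by (simp only: pderiv_linear_mult) (simp add: poly_prod)
qed

text \<open>At a zero \<open>w\<close> of \<open>Y\<^sub>n\<close> the recurrence leaves \<open>- w Y\<^sub>n'(w)\<close>, and at \<open>0\<close> it leaves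
  \<open>- (n + c) Y\<^sub>n(0)\<close>. Up to the minus sign both have the sign of a product of linear factors, so
  \<open>Y\<^sub>n\<^sub>+\<^sub>1\<close> alternates along \<open>0\<close> and the zeros of \<open>Y\<^sub>n\<close>.\<close>

lemma sign_next_laguerre:
  assumes c: "0 < c" and card: "card (laguerre_zeros c n) = n"
    and pos: "laguerre_zeros c n \<subseteq> {0<..}" and w: "w \<in> insert 0 (laguerre_zeros c n)"
  shows "(-1) ^ card {z \<in> laguerre_zeros c n. w < z} * poly (monic_laguerre c (Suc n)) w < 0"
proof (cases "w = 0")
  case True
  have "(-1) ^ card {z \<in> laguerre_zeros c n. 0 < z} * (\<Prod>z\<in>laguerre_zeros c n. 0 - z) > 0"
    using pos by (intro sign_linear_factors finite_laguerre_zeros) auto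
  moreover have "poly (monic_laguerre c n) 0 = (\<Prod>z\<in>laguerre_zeros c n. 0 - z)"
    by (subst monic_laguerre_factorization[OF card]) (simp add: poly_prod)
  moreover have "- (real n + c) < 0" using c by simp
  ultimately have "- (real n + c) * ((-1) ^ card {z \<in> laguerre_zeros c n. 0 < z} * poly (monic_laguerre c n) 0) < 0"
    by (intro mult_neg_pos) auto
  then show ?thesis using True unfolding poly_monic_laguerre_Suc by (simp add: algebra_simps)
next
  case False
  define Z where "Z = laguerre_zeros c n"
  have wZ: "w \<in> Z" and w0: "w > 0" using False w pos by (auto simp: Z_def)
  have fin: "finite Z" by (simp add: Z_def finite_laguerre_zeros)
  have "(-1) ^ card {z \<in> Z - {w}. w < z} * (\<Prod>z\<in>Z - {w}. w - z) > 0"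
    using fin by (intro sign_linear_factors) auto
  moreover have "{z \<in> Z - {w}. w < z} = {z \<in> Z. w < z}" by auto
  moreover have "poly (pderiv (monic_laguerre c n)) w = (\<Prod>z\<in>Z - {w}. w - z)"
    by (subst monic_laguerre_factorization[OF card])
       (use poly_pderiv_linear_factors_at_root[OF fin wZ] in \<open>simp add: Z_def\<close>)
  ultimately have "- w * ((-1) ^ card {z \<in> Z. w < z} * poly (pderiv (monic_laguerre c n)) w) < 0"
    using w0 by (intro mult_neg_pos) auto
  moreover have "poly (monic_laguerre c n) w = 0" using wZ by (simp add: Z_def laguerre_zeros_def)
  ultimately show ?thesis unfolding poly_monic_laguerre_Suc Z_def by (simp add: algebra_simps)
qed

lemma monic_laguerre_root_beyond:
  assumes "poly (monic_laguerre c n) w < 0"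
  shows "\<exists>r>w. poly (monic_laguerre c n) r = 0"
proof -
  obtain b where b: "\<And>x. x \<ge> b \<Longrightarrow> poly (monic_laguerre c n) x \<ge> 1"
    using poly_pinfty_gt_lc[of "monic_laguerre c n"] monic_laguerre_monic[of c n] by force
  have "poly (monic_laguerre c n) (max b (w + 1)) > 0" using b[of "max b (w + 1)"] by simp
  then show ?thesis
    using poly_IVT_pos[of w "max b (w + 1)" "monic_laguerre c n"] assms
    by (meson less_add_one less_le_trans max.cobounded2)
qed

lemma laguerre_zero_interlacing:
  assumes c: "0 < c" and card: "card (laguerre_zeros c n) = n"
    and pos: "laguerre_zeros c n \<subseteq> {0<..}" and w: "w \<in> insert 0 (laguerre_zeros c n)"
  shows "\<exists>r>w. r \<in> laguerre_zeros c (Suc n) \<and> (\<forall>z\<in>laguerre_zeros c n. w < z \<longrightarrow> r < z)"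
proof -
  define Z where "Z = laguerre_zeros c n"
  define U where "U = {z \<in> Z. w < z}"
  define p where "p = monic_laguerre c (Suc n)"
  have finU: "finite U" by (simp add: U_def Z_def finite_laguerre_zeros)
  have sw: "(-1) ^ card U * poly p w < 0"
    using sign_next_laguerre[OF assms] by (simp add: U_def Z_def p_def)
  show ?thesis
  proof (cases "U = {}")
    case True
    then have "\<exists>r>w. poly p r = 0"
      unfolding p_def using sw by (intro monic_laguerre_root_beyond) (simp only: p_def card.empty power_0 mult_1)
    then show ?thesis using True by (auto simp: U_def Z_def laguerre_zeros_def p_def)
  next
    case False
    define m where "m = Min U"
    have mU: "m \<in> U" using finU False by (simp add: m_def)
    have le: "m \<le> z" if "z \<in> U" for z using finU that by (simp add: m_def)
    have Um: "{z \<in> Z. m < z} = U - {m}" using mU le by (fastforce simp: U_def)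
    have cU: "card U = Suc (card {z \<in> Z. m < z})"
      unfolding Um using finU mU by (metis card.remove)
    have "(-1) ^ card {z \<in> Z. m < z} * poly p m < 0"
      using sign_next_laguerre[OF c card pos, of m] mU by (simp add: U_def Z_def p_def)
    then have "poly p w * poly p m < 0"
      using sw unfolding cU
      by (cases "even (card {z \<in> Z. m < z})") (auto simp: mult_less_0_iff)
    moreover have "w < m" using mU by (simp add: U_def)
    ultimately obtain r where "w < r" "r < m" "poly p r = 0"
      using poly_IVT by blast
    then show ?thesis using le by (fastforce simp: U_def Z_def laguerre_zeros_def p_def)
  qed
qed

text \<open>Interlacing gives a zero of \<open>Y\<^sub>n\<^sub>+\<^sub>1\<close> right after each of the \<open>n + 1\<close> points of
  \<open>insert 0 Z\<close>. These are different and exhaust the degree, so there are no other zeros, in particular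
  none that is not positive.\<close>

lemma laguerre_zeros_simple_pos:
  assumes c: "0 < c"
  shows "card (laguerre_zeros c n) = n \<and> laguerre_zeros c n \<subseteq> {0<..}"
proof (induction n)
  case 0
  then show ?case by (simp add: laguerre_zeros_def)
next
  case (Suc n)
  define Z where "Z = laguerre_zeros c n"
  have card: "card Z = n" and pos: "Z \<subseteq> {0<..}" using Suc by (auto simp: Z_def)
  have "\<forall>w\<in>insert 0 Z. \<exists>r>w. r \<in> laguerre_zeros c (Suc n) \<and> (\<forall>z\<in>Z. w < z \<longrightarrow> r < z)"
    using laguerre_zero_interlacing[OF c] Suc by (simp add: Z_def)
  then obtain g where g: "\<And>w. w \<in> insert 0 Z \<Longrightarrow> w < g w"
      "\<And>w. w \<in> insert 0 Z \<Longrightarrow> g w \<in> laguerre_zeros c (Suc n)"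
      "\<And>w z. w \<in> insert 0 Z \<Longrightarrow> z \<in> Z \<Longrightarrow> w < z \<Longrightarrow> g w < z"
    by metis
  have mono: "g v < g w" if "v \<in> insert 0 Z" "w \<in> insert 0 Z" "v < w" for v w
  proof -
    have "w \<in> Z" using that pos by auto
    then show ?thesis using g(1)[of w] g(3)[of v w] that by simp
  qed
  then have inj: "inj_on g (insert 0 Z)"
    by (intro linorder_inj_onI) (force)+
  have sub: "g ` insert 0 Z \<subseteq> laguerre_zeros c (Suc n)" using g(2) by blast
  have "0 \<notin> Z" using pos by auto
  then have "card (g ` insert 0 Z) = Suc n"
    using card inj finite_laguerre_zeros[of c n] by (simp add: card_image Z_def)
  moreover have "card (laguerre_zeros c (Suc n)) \<le> Suc n" by (rule card_laguerre_zeros_le)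
  ultimately have eq: "g ` insert 0 Z = laguerre_zeros c (Suc n)"
    using sub finite_laguerre_zeros by (intro card_seteq) auto
  moreover have "g w > 0" if "w \<in> insert 0 Z" for w using g(1)[OF that] that pos by auto
  ultimately show ?case
    using \<open>card (g ` insert 0 Z) = Suc n\<close> by (metis greaterThan_iff image_subsetI)
qed

section \<open>Power sums over the zeros\<close>

lemma linear_factors_pderiv:
  fixes Z :: "real set"
  assumes "finite Z" "x \<notin> Z"
  shows "poly (pderiv (\<Prod>z\<in>Z. [:- z, 1:])) x
    = poly (\<Prod>z\<in>Z. [:- z, 1:]) x * (\<Sum>z\<in>Z. 1 / (x - z))"
  using assms
proof (induction Z rule: finite_induct)
  case empty
  then show ?case by simp
next
  case (insert a Z)
  then have "x - a \<noteq> 0" by auto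
  with insert show ?case
    unfolding prod.insert[OF insert.hyps] sum.insert[OF insert.hyps] pderiv_linear_mult
    by (simp add: field_simps)
qed

lemma linear_factors_pderiv2:
  fixes Z :: "real set"
  assumes "finite Z" "x \<notin> Z"
  shows "poly (pderiv (pderiv (\<Prod>z\<in>Z. [:- z, 1:]))) x
    = poly (\<Prod>z\<in>Z. [:- z, 1:]) x * ((\<Sum>z\<in>Z. 1 / (x - z))\<^sup>2 - (\<Sum>z\<in>Z. 1 / (x - z)\<^sup>2))"
  using assms
proof (induction Z rule: finite_induct)
  case empty
  then show ?case by simp
next
  case (insert a Z)
  then have nz: "x - a \<noteq> 0" and x: "x \<notin> Z" by auto
  define R where "R = (\<Prod>z\<in>Z. [:- z, 1:])"
  define p where "p = (\<Sum>z\<in>Z. 1 / (x - z))"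
  define q where "q = (\<Sum>z\<in>Z. 1 / (x - z)\<^sup>2)"
  define d where "d = x - a"
  have "poly (pderiv (pderiv ([:- a, 1:] * R))) x = 2 * poly (pderiv R) x + d * poly (pderiv (pderiv R)) x"
    unfolding pderiv_linear_mult pderiv_add pderiv_smult by (simp add: algebra_simps d_def)
  also have "\<dots> = poly R x * (2 * p + d * (p\<^sup>2 - q))"
  proof -
    have "poly (pderiv (pderiv R)) x = poly R x * (p\<^sup>2 - q)" "poly (pderiv R) x = poly R x * p"
      using insert.IH[OF x] linear_factors_pderiv[OF insert.hyps(1) x]
      by (simp_all only: R_def p_def q_def)
    then show ?thesis by (simp only:) (simp add: algebra_simps)
  qed
  also have "\<dots> = d * poly R x * ((1 / d + p)\<^sup>2 - (1 / d\<^sup>2 + q))"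
    using nz by (simp add: d_def[symmetric] field_simps power2_eq_square)
  finally show ?case
    unfolding prod.insert[OF insert.hyps] sum.insert[OF insert.hyps]
    by (simp add: R_def p_def q_def d_def algebra_simps)
qed


text \<open>The logarithmic derivatives of \<open>Y\<^sub>n\<close> at \<open>0\<close> are power sums of \<open>1/z\<close>, and the differential
  equation and its derivative determine them because their leading coefficient vanishes at \<open>0\<close>.\<close>

lemma laguerre_inverse_power_sums:
  fixes c :: real and n :: nat
  defines "Z \<equiv> laguerre_zeros c n"
  assumes c: "0 < c"
  shows "c * (\<Sum>z\<in>Z. 1 / z) = n"
    and "(c + 1) * ((\<Sum>z\<in>Z. 1 / z)\<^sup>2 - (\<Sum>z\<in>Z. 1 / z\<^sup>2)) = (real n - 1) * (\<Sum>z\<in>Z. 1 / z)"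
proof -
  define R where "R = (\<Prod>z\<in>Z. [:- z, 1:])"
  define p where "p = (\<Sum>z\<in>Z. 1 / z)"
  define q where "q = (\<Sum>z\<in>Z. 1 / z\<^sup>2)"
  have fin: "finite Z" and card: "card (laguerre_zeros c n) = n" and nz: "0 \<notin> Z"
    using laguerre_zeros_simple_pos[OF c, of n] finite_laguerre_zeros by (auto simp: Z_def)
  have Y: "monic_laguerre c n = R"
    using monic_laguerre_factorization[OF card] by (simp add: R_def Z_def)
  have R0: "poly R 0 \<noteq> 0" using nz fin by (auto simp: R_def poly_prod)
  have R1: "poly (pderiv R) 0 = - (poly R 0 * p)"
    using linear_factors_pderiv[OF fin nz] by (simp add: R_def p_def sum_negf)
  have R2: "poly (pderiv (pderiv R)) 0 = poly R 0 * (p\<^sup>2 - q)"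
    using linear_factors_pderiv2[OF fin nz] by (simp add: R_def p_def q_def sum_negf)
  have "poly R 0 * (n - c * p) = 0"
    using monic_laguerre_ode[of 0 c n] by (simp add: Y R1 algebra_simps)
  then show "c * p = n" using R0 by simp
  have "poly R 0 * ((c + 1) * (p\<^sup>2 - q) - (real n - 1) * p) = 0"
    using monic_laguerre_ode_pderiv[of 0 c n] by (simp add: Y R1 R2 algebra_simps)
  then show "(c + 1) * (p\<^sup>2 - q) = (real n - 1) * p" using R0 by simp
qed

text \<open>Write \<open>Y\<^sub>n = (X - a) R\<close>. At \<open>a\<close> the derivatives of \<open>Y\<^sub>n\<close> of orders 1, 2, 3 are \<open>R\<close>, \<open>2 R'\<close>,
  \<open>3 R''\<close>, so the differential equation and its derivative determine the logarithmic
  derivatives of \<open>R\<close>, which are sums over the other zeros.\<close>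

lemma laguerre_stieltjes:
  fixes c a :: real and n :: nat
  defines "Z \<equiv> laguerre_zeros c n - {a}"
  assumes c: "0 < c" and a: "a \<in> laguerre_zeros c n"
  shows "2 * a * (\<Sum>z\<in>Z. 1 / (a - z)) = a - c"
    and "3 * a * ((\<Sum>z\<in>Z. 1 / (a - z))\<^sup>2 - (\<Sum>z\<in>Z. 1 / (a - z)\<^sup>2))
      + 2 * (c + 1 - a) * (\<Sum>z\<in>Z. 1 / (a - z)) + (real n - 1) = 0"
proof -
  define R where "R = (\<Prod>z\<in>Z. [:- z, 1:])"
  define p where "p = (\<Sum>z\<in>Z. 1 / (a - z))"
  define q where "q = (\<Sum>z\<in>Z. 1 / (a - z)\<^sup>2)"
  have fin: "finite Z" and card: "card (laguerre_zeros c n) = n" and nz: "a \<notin> Z"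
    using laguerre_zeros_simple_pos[OF c, of n] finite_laguerre_zeros by (auto simp: Z_def)
  have Y: "monic_laguerre c n = [:- a, 1:] * R"
    unfolding monic_laguerre_factorization[OF card] R_def Z_def
    using finite_laguerre_zeros a by (rule prod.remove)
  have d1: "pderiv (monic_laguerre c n) = R + [:- a, 1:] * pderiv R"
    unfolding Y pderiv_linear_mult by simp
  have twice: "P + P = smult 2 P" and thrice: "smult 2 P + P = smult 3 P" for P :: "real poly"
    using smult_add_left[of 1 1 P] smult_add_left[of 2 1 P] by simp_all
  have d2: "pderiv (pderiv (monic_laguerre c n)) = smult 2 (pderiv R) + [:- a, 1:] * pderiv (pderiv R)"
    unfolding d1 pderiv_linear_mult pderiv_add
    by (simp only: smult_1_left add.assoc[symmetric] twice)
  have d3: "pderiv (pderiv (pderiv (monic_laguerre c n))) =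
      smult 3 (pderiv (pderiv R)) + [:- a, 1:] * pderiv (pderiv (pderiv R))"
    unfolding d2 pderiv_linear_mult pderiv_add pderiv_smult
    by (simp only: smult_1_left add.assoc[symmetric] thrice)
  have R0: "poly R a \<noteq> 0" using nz fin by (auto simp: R_def poly_prod)
  have R1: "poly (pderiv R) a = poly R a * p"
    using linear_factors_pderiv[OF fin nz] by (simp only: R_def p_def)
  have R2: "poly (pderiv (pderiv R)) a = poly R a * (p\<^sup>2 - q)"
    using linear_factors_pderiv2[OF fin nz] by (simp only: R_def p_def q_def)
  have Ya: "poly (monic_laguerre c n) a = 0" using a by (simp add: laguerre_zeros_def)
  have "poly R a * (2 * a * p - (a - c)) = 0"
    using monic_laguerre_ode[of a c n] unfolding Ya unfolding d1 pderiv_linear_mult pderiv_add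
    by (simp add: R1 algebra_simps)
  then show "2 * a * p = a - c" using R0 by simp
  have "poly R a * (3 * a * (p\<^sup>2 - q) + 2 * (c + 1 - a) * p + (real n - 1)) = 0"
    using monic_laguerre_ode_pderiv[of a c n] unfolding d3 unfolding d2 unfolding d1
    by (simp add: R1 R2 algebra_simps)
  then show "3 * a * (p\<^sup>2 - q) + 2 * (c + 1 - a) * p + (real n - 1) = 0" using R0 by simp
qed

text \<open>With power sums \<open>p\<close> of \<open>1/z\<close> and \<open>q\<close> of \<open>1/z\<^sup>2\<close>, the smallest zero is at most \<open>p/q\<close>.
  A bound that does not decay in \<open>n\<close>, such as \<open>n/p = c\<close>, would force \<open>s\<close> below \<open>n + c/2\<close> by a
  constant, which the estimate at the largest zero cannot absorb.\<close>

lemma min_laguerre_zero_le: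
  assumes c: "0 < c" and n: "0 < n"
  shows "Min (laguerre_zeros c n) * (n + c) \<le> c * (c + 1)"
proof -
  define Z where "Z = laguerre_zeros c n"
  define a where "a = Min Z"
  define p where "p = (\<Sum>z\<in>Z. 1 / z)"
  define q where "q = (\<Sum>z\<in>Z. 1 / z\<^sup>2)"
  have fin: "finite Z" and pos: "\<And>z. z \<in> Z \<Longrightarrow> 0 < z" and "Z \<noteq> {}"
    using laguerre_zeros_simple_pos[OF c, of n] finite_laguerre_zeros n by (auto simp: Z_def)
  have "a * (1 / z\<^sup>2) \<le> 1 / z" if "z \<in> Z" for z
    using pos[OF that] fin that by (simp add: a_def divide_simps power2_eq_square)
  then have apq: "a * q \<le> p" unfolding p_def q_def sum_distrib_left by (rule sum_mono)
  have cp: "c * p = n" and cq: "(c + 1) * (p\<^sup>2 - q) = (real n - 1) * p"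
    using laguerre_inverse_power_sums[OF c, of n] by (simp_all add: p_def q_def Z_def)
  have p0: "p > 0" using cp c n by (metis mult_pos_pos of_nat_0_less_iff zero_less_mult_pos)
  have "c * ((c + 1) * q) = p * (n + c)"
  proof -
    have "(c + 1) * q = (c + 1) * p\<^sup>2 - (real n - 1) * p" using cq by (simp add: algebra_simps)
    also have "\<dots> = p * ((c * p) + p - n + 1)" by (simp add: algebra_simps power2_eq_square)
    also have "\<dots> = p * (p + 1)" using cp by simp
    finally have "c * ((c + 1) * q) = p * (c * p + c)" by (simp add: algebra_simps)
    then show ?thesis using cp by simp
  qed
  then have "a * (p * (n + c)) = a * (c * ((c + 1) * q))" by simp
  then have "p * (a * (n + c)) = c * (c + 1) * (a * q)" by (simp only: mult_ac)
  also have "\<dots> \<le> c * (c + 1) * p" using apq c by (intro mult_left_mono) auto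
  finally have "p * (a * (n + c)) \<le> p * (c * (c + 1))" by (simp add: algebra_simps)
  then show ?thesis using p0 by (simp add: a_def Z_def)
qed

section \<open>Movement of the extreme zeros\<close>

lemma monic_laguerre_Suc_eq:
  assumes c: "0 < c" and x: "x \<notin> laguerre_zeros c n"
  shows "poly (monic_laguerre c (Suc n)) x =
    poly (monic_laguerre c n) x * (x - n - c - (\<Sum>z\<in>laguerre_zeros c n. x / (x - z)))"
proof -
  have card: "card (laguerre_zeros c n) = n" using laguerre_zeros_simple_pos[OF c] by simp
  have "poly (pderiv (monic_laguerre c n)) x =
      poly (monic_laguerre c n) x * (\<Sum>z\<in>laguerre_zeros c n. 1 / (x - z))"
    using linear_factors_pderiv[OF finite_laguerre_zeros x]
    by (simp only: monic_laguerre_factorization[OF card, symmetric])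
  then show ?thesis
    unfolding poly_monic_laguerre_Suc by (simp add: sum_distrib_left algebra_simps)
qed

text \<open>A zero \<open>r \<le> a s / (s + 1)\<close> of \<open>Y\<^sub>n\<^sub>+\<^sub>1\<close> would satisfy \<open>n + c = r + \<Sum> r / (z - r)\<close>. The term
  of \<open>a\<close> is at most \<open>s\<close>; each other one is at most \<open>s / (s + 1)\<close> times \<open>a / (z - a)\<close>, and
  these add up to \<open>(c - a) / 2\<close> by the first Stieltjes sum.\<close>

lemma min_laguerre_zero_Suc_gt:
  assumes c: "0 < c" and n: "0 < n" and s: "0 < s"
    and key: "s + s / (s + 1) * ((c + Min (laguerre_zeros c n)) / 2) < n + c"
  shows "Min (laguerre_zeros c n) * (s / (s + 1)) < Min (laguerre_zeros c (Suc n))"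
proof -
  define Z where "Z = laguerre_zeros c n"
  define a where "a = Min Z"
  have fin: "finite Z" and pos: "\<And>z. z \<in> Z \<Longrightarrow> 0 < z" and "Z \<noteq> {}"
    using laguerre_zeros_simple_pos[OF c, of n] finite_laguerre_zeros n by (auto simp: Z_def)
  have aZ: "a \<in> Z" and a0: "0 < a" and le: "\<And>z. z \<in> Z \<Longrightarrow> a \<le> z"
    using fin \<open>Z \<noteq> {}\<close> pos by (simp_all add: a_def)
  have others: "(\<Sum>z\<in>Z - {a}. a / (z - a)) = (c - a) / 2"
  proof -
    have "(\<Sum>z\<in>Z - {a}. a / (z - a)) = - (a * (\<Sum>z\<in>Z - {a}. 1 / (a - z)))"
      unfolding sum_distrib_left sum_negf[symmetric]
      by (intro sum.cong refl) (metis minus_diff_eq minus_divide_right mult.right_neutral times_divide_eq_right)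
    then show ?thesis using laguerre_stieltjes(1)[OF c, of a n] aZ by (simp add: Z_def)
  qed
  have "a * (s / (s + 1)) < r" if r: "r \<in> laguerre_zeros c (Suc n)" for r
  proof (rule ccontr)
    assume "\<not> a * (s / (s + 1)) < r"
    then have ra: "r \<le> a * (s / (s + 1))" by simp
    have r0: "0 < r" using laguerre_zeros_simple_pos[OF c, of "Suc n"] r by auto
    have "a * (s / (s + 1)) < a" using a0 s by (simp add: divide_simps)
    then have "r < a" using ra by simp
    then have rZ: "r \<notin> Z" using le by force
    then have "poly (monic_laguerre c n) r \<noteq> 0" by (simp add: Z_def laguerre_zeros_def)
    then have eq: "r - n - c = (\<Sum>z\<in>Z. r / (r - z))"
      using monic_laguerre_Suc_eq[OF c, of r n] r rZ by (simp add: Z_def laguerre_zeros_def)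
    have "(\<Sum>z\<in>Z. r / (r - z)) = r / (r - a) + (\<Sum>z\<in>Z - {a}. r / (r - z))"
      using fin aZ by (rule sum.remove)
    moreover have "- s \<le> r / (r - a)"
    proof -
      have "r * (s + 1) \<le> a * s" using ra s by (simp add: field_simps)
      then show ?thesis using \<open>r < a\<close> by (simp add: divide_simps algebra_simps)
    qed
    moreover have "(\<Sum>z\<in>Z - {a}. r / (r - z)) \<ge> - (s / (s + 1) * ((c - a) / 2))"
    proof -
      have "- (s / (s + 1) * (a / (z - a))) \<le> r / (r - z)" if "z \<in> Z - {a}" for z
      proof -
        have za: "a < z" using le[of z] that by auto
        have "r / (z - r) \<le> (a * (s / (s + 1))) / (z - a)"
          using za ra r0 \<open>r < a\<close> by (intro frac_le) auto
        moreover have "r / (r - z) = - (r / (z - r))" by (metis minus_diff_eq minus_divide_right)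
        ultimately show ?thesis by (simp add: mult.commute)
      qed
      then have "(\<Sum>z\<in>Z - {a}. - (s / (s + 1) * (a / (z - a)))) \<le> (\<Sum>z\<in>Z - {a}. r / (r - z))"
        by (rule sum_mono)
      then show ?thesis unfolding sum_negf sum_distrib_left[symmetric] others .
    qed
    ultimately have "n + c \<le> s + s / (s + 1) * ((c - a) / 2) + a * (s / (s + 1))"
      using eq ra by linarith
    also have "\<dots> = s + s / (s + 1) * ((c + a) / 2)"
    proof -
      have "t * ((c - a) / 2) + a * t = t * ((c + a) / 2)" for t by (simp add: field_simps)
      then show ?thesis by (simp only: add.assoc)
    qed
    finally show False using key by (simp add: a_def Z_def)
  qed
  moreover have "laguerre_zeros c (Suc n) \<noteq> {}"
    using laguerre_zeros_simple_pos[OF c, of "Suc n"] by auto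
  ultimately show ?thesis
    using finite_laguerre_zeros[of c "Suc n"] by (simp add: a_def Z_def)
qed

text \<open>These are the value and, up to sign, the slope at \<open>X = b\<close> of the part of \<open>\<Phi>\<close> that comes from
  the zeros below the largest one. All these zeros being positive, the slope sum is nonnegative, and this
  bounds \<open>b\<close> from above.\<close>

lemma max_laguerre_zero_sum:
  fixes c :: real and n :: nat
  defines "b \<equiv> Max (laguerre_zeros c n)"
  defines "Z \<equiv> laguerre_zeros c n - {b}"
  assumes c: "0 < c" and n: "0 < n"
  shows "0 < b"
    and "(\<Sum>z\<in>Z. b / (b - z)) = (b - c) / 2"
    and "12 * b * (\<Sum>z\<in>Z. z / (b - z)\<^sup>2) = b * (4 * real n + 2 * c - b) - 6 * b + c * (2 - c)"
    and "0 \<le> b * (4 * real n + 2 * c - b) - 6 * b + c * (2 - c)"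
proof -
  define p where "p = (\<Sum>z\<in>Z. 1 / (b - z))"
  define q where "q = (\<Sum>z\<in>Z. 1 / (b - z)\<^sup>2)"
  have fin: "finite (laguerre_zeros c n)" and pos: "\<And>z. z \<in> laguerre_zeros c n \<Longrightarrow> 0 < z"
    and ne: "laguerre_zeros c n \<noteq> {}"
    using laguerre_zeros_simple_pos[OF c, of n] finite_laguerre_zeros n by auto
  have b: "b \<in> laguerre_zeros c n" using fin ne by (simp add: b_def)
  then show b0: "0 < b" by (rule pos)
  have st: "2 * b * p = b - c" "3 * b * (p\<^sup>2 - q) + 2 * (c + 1 - b) * p + (real n - 1) = 0"
    using laguerre_stieltjes[OF c b] by (simp_all only: p_def q_def Z_def)
  show "(\<Sum>z\<in>Z. b / (b - z)) = (b - c) / 2"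
  proof -
    have "b * p = (b - c) / 2" using st(1) by simp
    then show ?thesis by (simp add: p_def sum_distrib_left)
  qed
  have bz: "b - z \<noteq> 0" if "z \<in> Z" for z using that by (auto simp: Z_def)
  have "(\<Sum>z\<in>Z. z / (b - z)\<^sup>2) = (\<Sum>z\<in>Z. b * (1 / (b - z)\<^sup>2) - 1 / (b - z))"
    using bz by (intro sum.cong refl) (simp add: divide_simps power2_eq_square)
  also have "\<dots> = b * q - p" by (simp add: sum_subtractf sum_distrib_left p_def q_def)
  finally have S: "(\<Sum>z\<in>Z. z / (b - z)\<^sup>2) = b * q - p" .
  have "12 * b * (b * q - p) = 3 * (2 * b * p)\<^sup>2 + 4 * (c + 1 - b) * (2 * b * p)
      + 4 * b * (real n - 1) - 6 * (2 * b * p)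
      - 4 * b * (3 * b * (p\<^sup>2 - q) + 2 * (c + 1 - b) * p + (real n - 1))"
    by (simp add: algebra_simps power2_eq_square)
  also have "\<dots> = 3 * (2 * b * p)\<^sup>2 + 4 * (c + 1 - b) * (2 * b * p)
      + 4 * b * (real n - 1) - 6 * (2 * b * p)"
    unfolding st(2) by simp
  also have "\<dots> = b * (4 * real n + 2 * c - b) - 6 * b + c * (2 - c)"
    unfolding st(1) by (simp add: algebra_simps power2_eq_square)
  finally show eq: "12 * b * (\<Sum>z\<in>Z. z / (b - z)\<^sup>2) = b * (4 * real n + 2 * c - b) - 6 * b + c * (2 - c)"
    unfolding S .
  have "0 \<le> (\<Sum>z\<in>Z. z / (b - z)\<^sup>2)"
    by (intro sum_nonneg divide_nonneg_nonneg) (use pos in \<open>auto simp: Z_def intro: less_imp_le\<close>)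
  then show "0 \<le> b * (4 * real n + 2 * c - b) - 6 * b + c * (2 - c)"
    unfolding eq[symmetric] using b0 by simp
qed

text \<open>At \<open>x = b (s + 1) / s\<close> the function \<open>\<Phi>\<close> is positive: the term of \<open>b\<close> is \<open>s + 1\<close> and the
  others, convex in \<open>x\<close>, lie above their tangent lines at \<open>b\<close>. So the monic \<open>Y\<^sub>n\<^sub>+\<^sub>1\<close> is negative
  at \<open>x\<close> and has a zero beyond it.\<close>

lemma max_laguerre_zero_Suc_gt:
  fixes c s :: real and n :: nat
  defines "b \<equiv> Max (laguerre_zeros c n)"
  assumes c: "0 < c" and n: "0 < n" and s: "0 < s"
    and key: "(b * (4 * real n + 2 * c - b) + 6 * b + c * (2 - c)) / 12 < s * (s + 1 + n + c / 2 - b / 2)"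
  shows "b * ((s + 1) / s) < Max (laguerre_zeros c (Suc n))"
proof -
  define Z where "Z = laguerre_zeros c n"
  define x where "x = b * ((s + 1) / s)"
  define S where "S = (\<Sum>z\<in>Z - {b}. z / (b - z)\<^sup>2)"
  note top = max_laguerre_zero_sum[OF c n, folded b_def, folded Z_def, folded S_def]
  have fin: "finite Z" and "Z \<noteq> {}"
    using laguerre_zeros_simple_pos[OF c, of n] finite_laguerre_zeros n by (auto simp: Z_def)
  then have bZ: "b \<in> Z" and le: "\<And>z. z \<in> Z \<Longrightarrow> z \<le> b" by (simp_all add: b_def Z_def)
  have pos: "\<And>z. z \<in> Z \<Longrightarrow> 0 < z" using laguerre_zeros_simple_pos[OF c, of n] by (auto simp: Z_def)
  have xb: "x - b = b / s" using s by (simp add: x_def field_simps)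
  have bx: "b < x" using xb top(1) s by (metis diff_gt_0_iff_gt divide_pos_pos)
  have xZ: "x \<notin> Z" using le bx by force
  have "(\<Sum>z\<in>Z. x / (x - z)) = x / (x - b) + (\<Sum>z\<in>Z - {b}. x / (x - z))"
    using fin bZ by (rule sum.remove)
  moreover have "x / (x - b) = s + 1"
    using s top(1) unfolding xb by (simp add: x_def field_simps)
  moreover have "(\<Sum>z\<in>Z - {b}. x / (x - z)) \<ge> (b - c) / 2 - b / s * S"
  proof -
    \<comment> \<open>With \<open>d = b - z\<close> and \<open>h = x - b\<close> this is \<open>1 / (d + h) \<ge> 1 / d - h / d\<^sup>2\<close> times \<open>z\<close>, plus \<open>1\<close>.\<close>
    have "b / (b - z) - b / s * (z / (b - z)\<^sup>2) \<le> x / (x - z)" if z: "z \<in> Z - {b}" for z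
    proof -
      define d where "d = b - z"
      define h where "h = b / s"
      have d: "d > 0" using le[of z] z by (auto simp: d_def)
      have h: "h > 0" using top(1) s by (simp add: h_def)
      have "1 / d - h / d\<^sup>2 \<le> 1 / (d + h)"
      proof -
        have "(d - h) * (d + h) \<le> d\<^sup>2" by (simp add: algebra_simps power2_eq_square)
        then have "(d - h) / d\<^sup>2 \<le> 1 / (d + h)" using d h by (simp add: divide_simps)
        moreover have "(d - h) / d\<^sup>2 = 1 / d - h / d\<^sup>2"
          using d by (simp add: field_simps power2_eq_square)
        ultimately show ?thesis by simp
      qed
      then have "z * (1 / d - h / d\<^sup>2) \<le> z * (1 / (d + h))"
        using pos[of z] z by (intro mult_left_mono) auto
      then have "1 + z / d - h * (z / d\<^sup>2) \<le> 1 + z / (d + h)"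
        by (simp add: algebra_simps)
      moreover have "b / d = 1 + z / d" using d by (simp add: d_def field_simps)
      moreover have "x / (x - z) = 1 + z / (d + h)"
      proof -
        have "x - z = d + h" using xb by (simp add: d_def h_def)
        moreover have "x = (d + h) + z" using xb by (simp add: d_def h_def)
        ultimately show ?thesis using d h by (simp add: field_simps)
      qed
      ultimately show ?thesis unfolding d_def[symmetric] h_def[symmetric] by linarith
    qed
    then have "(\<Sum>z\<in>Z - {b}. b / (b - z) - b / s * (z / (b - z)\<^sup>2)) \<le> (\<Sum>z\<in>Z - {b}. x / (x - z))"
      by (rule sum_mono)
    then show ?thesis
      unfolding sum_subtractf sum_distrib_left[symmetric] top(2) S_def .
  qed
  moreover have "b / s * S + b / s < s + 1 + n + c / 2 - b / 2"
  proof -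
    have "b * S + b = (b * (4 * real n + 2 * c - b) + 6 * b + c * (2 - c)) / 12"
      using top(3) by (simp add: algebra_simps)
    then have "(b * S + b) / s < s + 1 + n + c / 2 - b / 2"
      using key s by (simp add: divide_less_eq mult.commute)
    then show ?thesis by (simp add: add_divide_distrib)
  qed
  ultimately have "x - n - c - (\<Sum>z\<in>Z. x / (x - z)) < 0"
    using xb by argo
  moreover have "poly (monic_laguerre c n) x > 0"
  proof -
    have card: "card (laguerre_zeros c n) = n" using laguerre_zeros_simple_pos[OF c] by simp
    have "0 < x - z" if "z \<in> Z" for z using le[OF that] bx by simp
    then have "0 < (\<Prod>z\<in>Z. x - z)" by (intro prod_pos) auto
    then show ?thesis
      by (subst monic_laguerre_factorization[OF card]) (simp add: poly_prod Z_def)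
  qed
  ultimately have "poly (monic_laguerre c (Suc n)) x < 0"
    using monic_laguerre_Suc_eq[OF c, of x n] xZ by (simp add: Z_def mult_pos_neg)
  then obtain r where "r > x" "r \<in> laguerre_zeros c (Suc n)"
    using monic_laguerre_root_beyond[of c "Suc n" x] by (auto simp: laguerre_zeros_def)
  then show ?thesis
    using finite_laguerre_zeros[of c "Suc n"] unfolding x_def
    by (meson Max_ge less_le_trans)
qed

text \<open>The condition amounts to \<open>a s < c + 2 d (s + 1)\<close>. Since \<open>a s < a (n + c) \<le> c + c\<^sup>2\<close>, it
  is enough that \<open>2 d (s + 1) \<ge> c\<^sup>2\<close>, and \<open>2 d n = c\<^sup>2\<close> achieves this because \<open>s + 1 \<ge> n\<close>.\<close>

lemma min_factor_condition:
  fixes a c d n s :: real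
  assumes "0 < a" "a * (n + c) \<le> c * (c + 1)" "0 < c" "0 < d" "d \<le> 1" "0 < s"
    and d: "2 * d * n = c\<^sup>2" and s: "s = n + c / 2 - d"
  shows "s + s / (s + 1) * ((c + a) / 2) < n + c"
proof -
  have "a * s < a * (n + c)" using assms by (intro mult_strict_left_mono) auto
  also have "\<dots> \<le> c + c\<^sup>2" using assms by (simp add: algebra_simps power2_eq_square)
  also have "\<dots> \<le> c + 2 * d * (s + 1)"
  proof -
    have "0 \<le> 2 * d * (c / 2 - d + 1)" using assms by (intro mult_nonneg_nonneg) auto
    then show ?thesis using d unfolding s by (simp add: algebra_simps)
  qed
  finally have "s * (c + a) < (c + 2 * d) * (s + 1)" by (simp add: algebra_simps)
  then have "s * (c + a) / (s + 1) < c + 2 * d"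
    using \<open>0 < s\<close> by (simp add: pos_divide_less_eq)
  moreover have "t / 2 < c / 2 + d" if "t < c + 2 * d" for t using that by linarith
  ultimately have "s * (c + a) / (s + 1) / 2 < c / 2 + d" by blast
  then have "s / (s + 1) * ((c + a) / 2) < c / 2 + d"
    by (simp only: times_divide_eq_left times_divide_eq_right)
  then show ?thesis unfolding s by simp
qed

text \<open>With \<open>Q = 4 n + 2 c - b\<close> the difference of the two sides is, up to a factor,
  \<open>b (Q - 6) + 3 Q\<^sup>2\<close> plus terms at most linear in \<open>Q\<close> with small coefficients. The hypothesis \<open>gap\<close>
  makes the first summand at least \<open>-1\<close> and so forces \<open>Q \<ge> 5\<close>, where the square dominates.\<close>

lemma max_factor_condition:
  fixes b c d n s :: real
  assumes b: "0 < b" and c: "0 < c" "c \<le> 3 / 2" and n: "2 \<le> n"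
    and d: "2 * d * n = c\<^sup>2" "0 < d" "d \<le> 9 / 16" and s: "s = n + c / 2 - d"
    and gap: "0 \<le> b * (4 * n + 2 * c - b) - 6 * b + c * (2 - c)"
  shows "(b * (4 * n + 2 * c - b) + 6 * b + c * (2 - c)) / 12 < s * (s + 1 + n + c / 2 - b / 2)"
proof -
  define Q where "Q = 4 * n + 2 * c - b"
  define K where "K = c * (2 - c)"
  have K: "K \<le> 1" using zero_le_power2[of "c - 1"] by (simp add: K_def power2_eq_square algebra_simps)
  have gap: "- K \<le> b * (Q - 6)" using gap by (simp add: Q_def K_def algebra_simps)
  have Q: "5 \<le> Q"
  proof (rule ccontr)
    assume "\<not> 5 \<le> Q"
    then have "Q < 5" "3 < b" using c n by (simp_all add: Q_def)
    then have "3 * 1 < b * (6 - Q)" by (intro mult_strict_mono) auto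
    then show False using gap K by (simp add: algebra_simps)
  qed
  have dn: "d * (b + Q) \<le> 99 / 16"
  proof -
    have "d * (b + Q) = 2 * c\<^sup>2 + 2 * d * c" using d(1) by (simp add: Q_def algebra_simps)
    moreover have "c\<^sup>2 \<le> (3 / 2)\<^sup>2" using c by (intro power_mono) auto
    moreover have "d * c \<le> 9 / 16 * (3 / 2)" using c d by (intro mult_mono) auto
    ultimately show ?thesis by (simp add: power2_eq_square)
  qed
  have dQ: "d * Q \<le> 9 / 16 * Q" using d Q by (intro mult_right_mono) auto
  have QQ: "5 * Q \<le> Q * Q" using Q by (intro mult_right_mono) auto
  have dd: "0 \<le> d * d" by simp
  have "24 * (s * (s + 1 + n + c / 2 - b / 2)) - 2 * (b * Q + 6 * b + K)
      = b * (Q - 6) - 6 * (d * (b + Q)) + 3 * (Q * Q) + 6 * Q - 12 * (d * Q) - 24 * d + 24 * (d * d) - 2 * K"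
    unfolding s Q_def by (simp add: algebra_simps)
  also have "\<dots> > 0" using gap K dn dQ QQ dd Q d by linarith
  finally show ?thesis by (simp add: Q_def K_def)
qed

theorem laguerre_min_times_max_mono:
  fixes c :: real
  assumes c: "0 < c" "c \<le> 3 / 2" and n: "2 \<le> n"
  shows "Min (laguerre_zeros c n) * Max (laguerre_zeros c n)
    < Min (laguerre_zeros c (Suc n)) * Max (laguerre_zeros c (Suc n))"
proof -
  define a where "a = Min (laguerre_zeros c n)"
  define b where "b = Max (laguerre_zeros c n)"
  define d where "d = c\<^sup>2 / (2 * n)"
  define s where "s = n + c / 2 - d"
  have n': "0 < n" "2 \<le> real n" using n by auto
  have d: "2 * d * n = c\<^sup>2" "0 < d" using n' c by (simp_all add: d_def)
  have d_le: "d \<le> 9 / 16"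
  proof -
    have "c\<^sup>2 \<le> (3 / 2)\<^sup>2" using c by (intro power_mono) auto
    moreover have "4 * d \<le> c\<^sup>2"
      using mult_left_mono[OF n'(2), of "2 * d"] d by simp
    ultimately show ?thesis by (simp add: power2_eq_square)
  qed
  have s: "0 < s" using d_le n' c by (simp add: s_def)
  have fin: "finite (laguerre_zeros c n)" and "laguerre_zeros c n \<noteq> {}" "laguerre_zeros c n \<subseteq> {0<..}"
    using laguerre_zeros_simple_pos[OF c(1), of n] finite_laguerre_zeros n' by auto
  then have a: "0 < a" using Min_in by (auto simp: a_def)
  note top = max_laguerre_zero_sum[OF c(1) n'(1), folded b_def]
  have b: "0 < b" by (rule top(1))
  have "a * (n + c) \<le> c * (c + 1)"
    unfolding a_def by (rule min_laguerre_zero_le[OF c(1) n'(1)])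
  then have "s + s / (s + 1) * ((c + a) / 2) < n + c"
    using a c d d_le s by (intro min_factor_condition[where d = d]) (auto simp: s_def)
  then have lo: "a * (s / (s + 1)) < Min (laguerre_zeros c (Suc n))"
    unfolding a_def by (intro min_laguerre_zero_Suc_gt c n' s)
  have "(b * (4 * real n + 2 * c - b) + 6 * b + c * (2 - c)) / 12 < s * (s + 1 + n + c / 2 - b / 2)"
    using b c n'(2) d d_le s_def top(4) by (rule max_factor_condition)
  then have hi: "b * ((s + 1) / s) < Max (laguerre_zeros c (Suc n))"
    unfolding b_def by (intro max_laguerre_zero_Suc_gt c n' s)
  have "a * b = (a * (s / (s + 1))) * (b * ((s + 1) / s))" using s by simp
  also have "\<dots> < Min (laguerre_zeros c (Suc n)) * Max (laguerre_zeros c (Suc n))"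
  proof (rule mult_strict_mono[OF lo hi])
    have "0 < a * (s / (s + 1))" using a s by simp
    then show "0 < Min (laguerre_zeros c (Suc n))" using lo by simp
    show "0 \<le> b * ((s + 1) / s)" using b s by simp
  qed
  finally show ?thesis by (simp add: a_def b_def)
qed

section \<open>Hermite polynomials\<close>

lemma gaussian_even_deriv:
  "((\<lambda>x. k * (poly P (x\<^sup>2) * exp (- (x\<^sup>2)))) has_real_derivative
    k * (2 * x * poly (pderiv P - P) (x\<^sup>2) * exp (- (x\<^sup>2)))) (at x)"
  by (auto intro!: derivative_eq_intros DERIV_chain'[OF _ poly_DERIV, of _ _ x] simp: algebra_simps)

lemma gaussian_odd_deriv:
  "((\<lambda>x. k * (2 * x * poly P (x\<^sup>2) * exp (- (x\<^sup>2)))) has_real_derivative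
    2 * k * (poly (P + [:0, 2:] * (pderiv P - P)) (x\<^sup>2) * exp (- (x\<^sup>2)))) (at x)"
  by (auto intro!: derivative_eq_intros DERIV_chain'[OF _ poly_DERIV, of _ _ x]
      simp: algebra_simps power2_eq_square)

text \<open>Two differentiations map \<open>P(x\<^sup>2) exp (-x\<^sup>2)\<close> to a function of the same form; when
  \<open>P\<close> solves the Laguerre equation, its second derivative can be eliminated and what
  remains is the recurrence.\<close>

lemma gaussian_deriv_even:
  "(deriv ^^ (2 * n)) (\<lambda>t. exp (- (t\<^sup>2))) =
    (\<lambda>x. 4 ^ n * (poly (monic_laguerre (1 / 2) n) (x\<^sup>2) * exp (- (x\<^sup>2))))"
proof (induction n)
  case 0
  then show ?case by simp
next
  case (Suc n)
  define Y where "Y = monic_laguerre (1 / 2) n"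
  define P where "P = pderiv Y - Y"
  have next_Y: "P + [:0, 2:] * (pderiv P - P) = smult 2 (monic_laguerre (1 / 2) (Suc n))"
  proof (rule poly_ext)
    fix u
    show "poly (P + [:0, 2:] * (pderiv P - P)) u = poly (smult 2 (monic_laguerre (1 / 2) (Suc n))) u"
      using monic_laguerre_ode[of u "1 / 2" n, folded Y_def]
      by (simp add: P_def pderiv_diff poly_monic_laguerre_Suc Y_def[symmetric] algebra_simps)
  qed
  have "deriv (deriv (\<lambda>x. 4 ^ n * (poly Y (x\<^sup>2) * exp (- (x\<^sup>2))))) =
      deriv (\<lambda>x. 4 ^ n * (2 * x * poly P (x\<^sup>2) * exp (- (x\<^sup>2))))"
    unfolding P_def by (intro arg_cong[where f = deriv] ext DERIV_imp_deriv gaussian_even_deriv)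
  also have "\<dots> = (\<lambda>x. 2 * 4 ^ n * (poly (P + [:0, 2:] * (pderiv P - P)) (x\<^sup>2) * exp (- (x\<^sup>2))))"
    by (intro ext DERIV_imp_deriv gaussian_odd_deriv)
  also have "\<dots> = (\<lambda>x. 4 ^ Suc n * (poly (monic_laguerre (1 / 2) (Suc n)) (x\<^sup>2) * exp (- (x\<^sup>2))))"
    unfolding next_Y by (simp add: fun_eq_iff)
  finally show ?case using Suc by (simp add: Y_def)
qed

lemma gaussian_deriv_odd:
  "(deriv ^^ (2 * n + 1)) (\<lambda>t. exp (- (t\<^sup>2))) =
    (\<lambda>x. - (4 ^ n) * (2 * x * poly (monic_laguerre (3 / 2) n) (x\<^sup>2) * exp (- (x\<^sup>2))))"
proof (induction n)
  case 0
  have "deriv (\<lambda>x. 1 * (poly 1 (x\<^sup>2) * exp (- (x\<^sup>2)))) =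
      (\<lambda>x::real. 1 * (2 * x * poly (pderiv 1 - 1) (x\<^sup>2) * exp (- (x\<^sup>2))))"
    by (intro ext DERIV_imp_deriv gaussian_even_deriv)
  then show ?case by (simp add: pderiv_1)
next
  case (Suc n)
  define Y where "Y = monic_laguerre (3 / 2) n"
  define P where "P = Y + [:0, 2:] * (pderiv Y - Y)"
  have next_Y: "pderiv P - P = smult 2 (monic_laguerre (3 / 2) (Suc n))"
  proof (rule poly_ext)
    fix u
    have "pderiv P = pderiv Y + (smult 2 (pderiv Y - Y) + [:0, 2:] * (pderiv (pderiv Y) - pderiv Y))"
      unfolding P_def pderiv_add pderiv_linear_mult pderiv_diff ..
    then show "poly (pderiv P - P) u = poly (smult 2 (monic_laguerre (3 / 2) (Suc n))) u"
      using monic_laguerre_ode[of u "3 / 2" n, folded Y_def]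
      by (simp add: P_def poly_monic_laguerre_Suc Y_def[symmetric] algebra_simps)
  qed
  have "deriv (deriv (\<lambda>x. - (4 ^ n) * (2 * x * poly Y (x\<^sup>2) * exp (- (x\<^sup>2))))) =
      deriv (\<lambda>x. 2 * - (4 ^ n) * (poly P (x\<^sup>2) * exp (- (x\<^sup>2))))"
    unfolding P_def by (intro arg_cong[where f = deriv] ext DERIV_imp_deriv gaussian_odd_deriv)
  also have "\<dots> = (\<lambda>x. 2 * - (4 ^ n) * (2 * x * poly (pderiv P - P) (x\<^sup>2) * exp (- (x\<^sup>2))))"
    by (intro ext DERIV_imp_deriv gaussian_even_deriv)
  also have "\<dots> = (\<lambda>x. - (4 ^ Suc n) * (2 * x * poly (monic_laguerre (3 / 2) (Suc n)) (x\<^sup>2) * exp (- (x\<^sup>2))))"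
    unfolding next_Y by (simp add: fun_eq_iff)
  finally show ?case using Suc by (simp add: Y_def)
qed

lemma hermite_even: "hermite (2 * n) x = 4 ^ n * poly (monic_laguerre (1 / 2) n) (x\<^sup>2)"
  unfolding hermite_def gaussian_deriv_even by (simp add: exp_minus field_simps)

lemma hermite_odd: "hermite (2 * n + 1) x = 4 ^ n * (2 * x) * poly (monic_laguerre (3 / 2) n) (x\<^sup>2)"
  unfolding hermite_def gaussian_deriv_odd by (simp add: exp_minus field_simps)

lemma hermite_zero_iff:
  assumes "0 < x"
  shows "hermite N x = 0 \<longleftrightarrow> x\<^sup>2 \<in> laguerre_zeros (1 / 2 + real (N mod 2)) (N div 2)"
proof (cases "even N")
  case True
  then show ?thesis using hermite_even[of "N div 2" x] by (simp add: laguerre_zeros_def)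
next
  case False
  then have "N mod 2 = 1" by presburger
  then show ?thesis using False assms hermite_odd[of "N div 2" x] by (simp add: laguerre_zeros_def)
qed

lemma hermite_pos_zeros_eq:
  "hermite_pos_zeros N = sqrt ` laguerre_zeros (1 / 2 + real (N mod 2)) (N div 2)"
    (is "_ = sqrt ` ?Z")
proof -
  have pos: "?Z \<subseteq> {0<..}" by (rule laguerre_zeros_simple_pos[THEN conjunct2]) simp
  have "x \<in> hermite_pos_zeros N \<longleftrightarrow> x \<in> sqrt ` ?Z" for x
  proof
    assume "x \<in> hermite_pos_zeros N"
    then have "0 < x" "x\<^sup>2 \<in> ?Z" using hermite_zero_iff by (auto simp: hermite_pos_zeros_def)
    then show "x \<in> sqrt ` ?Z" by (intro image_eqI[of _ _ "x\<^sup>2"]) auto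
  next
    assume "x \<in> sqrt ` ?Z"
    then obtain z where "z \<in> ?Z" "x = sqrt z" by auto
    then have "0 < x" "x\<^sup>2 \<in> ?Z" using pos by auto
    then show "x \<in> hermite_pos_zeros N" using hermite_zero_iff by (auto simp: hermite_pos_zeros_def)
  qed
  then show ?thesis by blast
qed

lemma sorted_list_of_set_Min_Max:
  assumes "finite S" "S \<noteq> {}"
  shows "sorted_list_of_set S ! 0 = Min S" "sorted_list_of_set S ! (card S - 1) = Max S"
proof -
  define L where "L = sorted_list_of_set S"
  have L: "sorted L" "set L = S" "length L = card S" using assms by (simp_all add: L_def)
  have pos: "0 < card S" using assms by (simp add: card_gt_0_iff)
  have mem: "L ! 0 \<in> S" "L ! (card S - 1) \<in> S" using L pos by (auto intro: nth_mem)
  have "L ! 0 \<le> x \<and> x \<le> L ! (card S - 1)" if x: "x \<in> S" for x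
  proof -
    obtain i where "i < length L" "x = L ! i" using L x by (metis in_set_conv_nth)
    then show ?thesis using L by (auto intro!: sorted_nth_mono)
  qed
  then show "L ! 0 = Min S" "L ! (card S - 1) = Max S"
    using mem assms by (auto intro!: Min_eqI[symmetric] Max_eqI[symmetric])
qed

lemma varpi_eq:
  fixes N :: nat
  defines "Z \<equiv> laguerre_zeros (1 / 2 + real (N mod 2)) (N div 2)"
  assumes "2 \<le> N"
  shows "varpi N = sqrt (Min Z * Max Z)"
proof -
  define S where "S = hermite_pos_zeros N"
  have S: "S = sqrt ` Z" by (simp add: S_def Z_def hermite_pos_zeros_eq)
  have card: "card Z = N div 2"
    unfolding Z_def by (rule laguerre_zeros_simple_pos[THEN conjunct1]) simp
  have finZ: "finite Z" by (simp add: Z_def finite_laguerre_zeros)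
  have "Z \<noteq> {}" using card assms by auto
  have cardS: "card S = N div 2" unfolding S card[symmetric] by (intro card_image) (auto intro: inj_onI)
  have "finite S" "S \<noteq> {}" using finZ \<open>Z \<noteq> {}\<close> by (simp_all add: S)
  then have "hermite_zero 1 N = Min S" "hermite_zero (N div 2) N = Max S"
    using sorted_list_of_set_Min_Max[of S] by (simp_all add: hermite_zero_def S_def[symmetric] cardS)
  moreover have "mono sqrt" by (intro monoI real_sqrt_le_mono)
  then have "Min S = sqrt (Min Z)" "Max S = sqrt (Max Z)"
    unfolding S using finZ \<open>Z \<noteq> {}\<close> by (simp_all add: mono_Min_commute mono_Max_commute)
  ultimately show ?thesis by (simp add: varpi_def real_sqrt_mult)
qed

theorem mainTheorem3:
  fixes N :: nat
  assumes "4 \<le> N"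
  shows "varpi N < varpi (N + 2)"
proof -
  define c where "c = 1 / 2 + real (N mod 2)"
  have c: "0 < c" "c \<le> 3 / 2" by (auto simp: c_def)
  have "2 \<le> N div 2" using assms by simp
  then have "Min (laguerre_zeros c (N div 2)) * Max (laguerre_zeros c (N div 2))
      < Min (laguerre_zeros c (Suc (N div 2))) * Max (laguerre_zeros c (Suc (N div 2)))"
    by (rule laguerre_min_times_max_mono[OF c])
  then show ?thesis
    using varpi_eq[of N] varpi_eq[of "N + 2"] assms by (simp add: c_def)
qed

end
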